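(* Let $f:\mathbb{R}^n\to\mathbb{R}$ be smooth in a neighborhood of $\bar x\in\mathbb{R}^n$, let $H(\bar x)$ be the Hessian matrix of $f$ at $\bar x$, and let $g_4(\bar x,\cdot)$ be the fourth order term in the Taylor expansion of $f$ at $\bar x$. Let $V\in\mathbf{O}(n)$ be an orthogonal matrix such that every element of the group $$\Gamma(\bar x)=\{V^T\sigma V:\sigma\in\Sigma\}$$ commutes with $H(\bar x)$, where $\Sigma\subset\mathbf{O}(n)$ is the group of the $2^n$ diagonal matrices with all diagonal entries $\pm1$. Then for all $\gamma\in\Gamma(\bar x)$ we have, as $h\to 0$ in $\mathbb{R}^n$, $$f(\bar x+\gamma h)-2f(\bar x)+f(\bar x-\gamma h)=h^TH(\bar x)h+2g_4(\bar x,\gamma h)+O(\|h\|^6),$$ and therefore for all $\gamma_1,\gamma_2\in\Gamma(\bar x)$, as $h\to0$, $$f(\bar x+\gamma_1h)+f(\bar x-\gamma_1h)-f(\bar x+\gamma_2h)-f(\bar x-\gamma_2h)=2\bigl(g_4(\bar x,\gamma_1h)-g_4(\bar x,\gamma_2h)\bigr)+O(\|h\|^6).$$ In particular, $$f(\bar x+\gamma_1h)+f(\bar x-\gamma_1h)-f(\bar x+\gamma_2h)-f(\bar x-\gamma_2h)=O(\|h\|^4)\quad\text{as } h\to 0.$$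
   Context: $\mathbf{O}(n)$ is the group of real orthogonal $n\times n$ matrices and $\|\cdot\|$ is a norm on $\mathbb{R}^n$. Smooth means $C^\infty$. The Taylor expansion of $f$ at $\bar x$ is written as $$f(\bar x+h)=f(\bar x)+\nabla f(\bar x)^Th+\tfrac12h^TH(\bar x)h+\sum_{j=3}^\infty g_j(\bar x,h),$$ where $g_j(\bar x,h)=O(\|h\|^j)$ is the term of order $j$, i.e. $g_j(\bar x,h)=\frac1{j!}D^jf(\bar x)[h,\ldots,h]$, the homogeneous Taylor polynomial of degree $j$ in $h$. The expansion is understood in the asymptotic sense (for each $m\ge 3$, the error after truncating the sum at $j=m$ is $O(\|h\|^{m+1})$ as $h\to0$). *)

theory Defs
  imports "HOL-Analysis.Analysis" "HOL-Library.Landau_Symbols"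
begin

definition is_norm :: "('a::real_vector \<Rightarrow> real) \<Rightarrow> bool" where
  "is_norm N \<longleftrightarrow>
     (\<forall>x. 0 \<le> N x) \<and> (\<forall>x. N x = 0 \<longleftrightarrow> x = 0) \<and>
     (\<forall>c x. N (c *\<^sub>R x) = \<bar>c\<bar> * N x) \<and> (\<forall>x y. N (x + y) \<le> N x + N y)"

text \<open>\<open>iter_deriv f [v\<^sub>1, \<dots>, v\<^sub>j] x\<close> is \<open>D\<^sup>j f(x)[v\<^sub>1, \<dots>, v\<^sub>j]\<close>, where \<open>v\<^sub>j\<close> is the direction of the
  innermost derivative. It is meaningful only where the derivatives involved exist, since
  \<open>frechet_derivative\<close> is a choice operator.\<close>

primrec iter_deriv :: "('a::real_normed_vector \<Rightarrow> real) \<Rightarrow> 'a list \<Rightarrow> 'a \<Rightarrow> real" where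
  "iter_deriv f [] = f"
| "iter_deriv f (v # vs) = (\<lambda>x. frechet_derivative (iter_deriv f vs) (at x) v)"

text \<open>\<open>C\<^sup>\<infinity>\<close> on an open set. As the domain is finite-dimensional, \<open>D\<^sup>j f\<close> is Frechet differentiable
  iff each of its evaluations \<open>x \<mapsto> D\<^sup>j f(x)[v\<^sub>1, \<dots>, v\<^sub>j]\<close> is; continuity of all derivatives follows
  from differentiability at the next order.\<close>

definition smooth_on :: "'a::euclidean_space set \<Rightarrow> ('a \<Rightarrow> real) \<Rightarrow> bool" where
  "smooth_on U f \<longleftrightarrow> open U \<and> (\<forall>vs. \<forall>x\<in>U. iter_deriv f vs differentiable (at x))"

definition hessian :: "(real ^ 'n \<Rightarrow> real) \<Rightarrow> real ^ 'n \<Rightarrow> real ^ 'n ^ 'n" where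
  "hessian f x = (\<chi> i j. iter_deriv f [axis i 1, axis j 1] x)"

definition taylor_term :: "nat \<Rightarrow> ('a::real_normed_vector \<Rightarrow> real) \<Rightarrow> 'a \<Rightarrow> 'a \<Rightarrow> real" where
  "taylor_term j f x h = iter_deriv f (replicate j h) x / fact j"

definition sign_matrices :: "(real ^ 'n ^ 'n) set" where
  "sign_matrices =
     {S. (\<forall>i j. i \<noteq> j \<longrightarrow> S $ i $ j = 0) \<and> (\<forall>i. S $ i $ i = 1 \<or> S $ i $ i = - 1)}"

definition Gamma_group :: "real ^ 'n ^ 'n \<Rightarrow> (real ^ 'n ^ 'n) set" where
  "Gamma_group V = {transpose V ** S ** V | S. S \<in> sign_matrices}"

end

theory Submission
  imports Defs
begin

text \<open>The Taylor polynomial of degree five has an \<open>O(\<parallel>h\<parallel>\<^sup>6)\<close> remainder, and in the sum of its values at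
  \<open>h\<close> and \<open>-h\<close> the odd terms cancel. Every \<open>\<gamma>\<close> in the group is an orthogonal matrix that commutes with the
  Hessian, so \<open>\<gamma>\<close> preserves both the size of \<open>h\<close> and the quadratic term.\<close>

section \<open>Iterated derivatives\<close>

lemma smooth_on_has_derivative:
  assumes "smooth_on U f" "x \<in> U"
  shows "(iter_deriv f vs has_derivative (\<lambda>v. iter_deriv f (v # vs) x)) (at x)"
  using assms by (simp add: smooth_on_def frechet_derivative_works)

text \<open>The outermost slot is linear because a Frechet derivative is. For an inner slot,
  linearity at every point of the open set \<open>U\<close> is an identity of functions near
  \<open>x\<close>; differentiating it in direction \<open>w\<close> and using uniqueness of
  derivatives carries it one level up. Hence the induction keeps \<open>x\<close> arbitrary.\<close>

lemma smooth_on_slot_linear: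
  assumes "smooth_on U f" "x \<in> U"
  shows "linear (\<lambda>v. iter_deriv f (ws @ v # vs) x)"
  using \<open>x \<in> U\<close>
proof (induction ws arbitrary: x)
  case Nil
  then show ?case
    using has_derivative_linear[OF smooth_on_has_derivative[OF assms(1)]] by simp
next
  case (Cons w ws)
  have "open U"
    using assms(1) by (simp add: smooth_on_def)
  have deriv: "(iter_deriv f us has_derivative (\<lambda>v. iter_deriv f (v # us) x)) (at x)" for us
    using smooth_on_has_derivative[OF assms(1) Cons.prems] .
  have "iter_deriv f (w # ws @ (u + v) # vs) x =
      iter_deriv f (w # ws @ u # vs) x + iter_deriv f (w # ws @ v # vs) x" for u v
  proof -
    have "((\<lambda>y. iter_deriv f (ws @ u # vs) y + iter_deriv f (ws @ v # vs) y) has_derivative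
        (\<lambda>w. iter_deriv f (w # ws @ (u + v) # vs) x)) (at x)"
      by (rule has_derivative_transform_within_open[OF deriv \<open>open U\<close> Cons.prems])
        (simp add: linear_add[OF Cons.IH])
    from has_derivative_unique[OF this has_derivative_add[OF deriv deriv]]
    show ?thesis by (rule fun_cong)
  qed
  moreover have "iter_deriv f (w # ws @ (c *\<^sub>R v) # vs) x = c *\<^sub>R iter_deriv f (w # ws @ v # vs) x"
    for c v
  proof -
    have "((\<lambda>y. c *\<^sub>R iter_deriv f (ws @ v # vs) y) has_derivative
        (\<lambda>w. iter_deriv f (w # ws @ (c *\<^sub>R v) # vs) x)) (at x)"
      by (rule has_derivative_transform_within_open[OF deriv \<open>open U\<close> Cons.prems])
        (simp add: linear_scale[OF Cons.IH])
    from has_derivative_unique[OF this has_derivative_scaleR_right[OF deriv]]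
    show ?thesis by (rule fun_cong)
  qed
  ultimately show ?case
    unfolding append_Cons by (intro linearI)
qed

lemma smooth_on_slot_expansion:
  fixes f :: "'a::euclidean_space \<Rightarrow> real"
  assumes "smooth_on U f" "x \<in> U"
  shows "iter_deriv f (ws @ h # vs) x = (\<Sum>b\<in>Basis. (h \<bullet> b) * iter_deriv f (ws @ b # vs) x)"
proof -
  note lin = smooth_on_slot_linear[OF assms, of ws vs]
  have "iter_deriv f (ws @ (\<Sum>b\<in>Basis. (h \<bullet> b) *\<^sub>R b) # vs) x =
      (\<Sum>b\<in>Basis. (h \<bullet> b) *\<^sub>R iter_deriv f (ws @ b # vs) x)"
    by (simp add: linear_sum[OF lin] linear_scale[OF lin])
  then show ?thesis
    by (simp add: euclidean_representation)
qed

text \<open>The tail \<open>vs\<close> is there for the induction: once linearity has freed the last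
  of the repeated slots from its factor \<open>c\<close>, that slot joins the tail.\<close>

lemma iter_deriv_replicate_scaleR:
  fixes f :: "'a::euclidean_space \<Rightarrow> real"
  assumes "smooth_on U f" "x \<in> U"
  shows "iter_deriv f (replicate k (c *\<^sub>R h) @ vs) x = c ^ k * iter_deriv f (replicate k h @ vs) x"
proof (induction k arbitrary: vs)
  case (Suc k)
  have "iter_deriv f (replicate (Suc k) (c *\<^sub>R h) @ vs) x =
      iter_deriv f (replicate k (c *\<^sub>R h) @ (c *\<^sub>R h) # vs) x"
    by (simp only: replicate_Suc replicate_append_same[symmetric]) simp
  also have "\<dots> = c ^ Suc k * iter_deriv f (replicate k h @ h # vs) x"
    using linear_scale[OF smooth_on_slot_linear[OF assms]] Suc.IH by simp
  also have "replicate k h @ h # vs = replicate (Suc k) h @ vs"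
    by (simp only: replicate_Suc replicate_append_same[symmetric]) simp
  finally show ?case .
qed simp

lemma taylor_term_uminus:
  fixes f :: "'a::euclidean_space \<Rightarrow> real"
  assumes "smooth_on U f" "x \<in> U"
  shows "taylor_term k f x (- h) = (- 1) ^ k * taylor_term k f x h"
  using iter_deriv_replicate_scaleR[OF assms, of k "- 1" h "[]"] by (simp add: taylor_term_def)

text \<open>Uniformity over \<open>K\<close> matters because the intermediate point in the Taylor
  remainder moves with \<open>h\<close>. The induction trades each copy of \<open>h\<close> for a
  basis vector in the tail, at the price of a factor \<open>norm h\<close>; what remains are
  derivatives in fixed directions, which are continuous and so bounded on the compact
  \<open>K\<close>.\<close>

lemma iter_deriv_replicate_bound:
  fixes f :: "'a::euclidean_space \<Rightarrow> real"
  assumes "smooth_on U f" "compact K" "K \<subseteq> U"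
  shows "\<exists>C. \<forall>y\<in>K. \<forall>h. \<bar>iter_deriv f (replicate k h @ vs) y\<bar> \<le> C * norm h ^ k"
proof (induction k arbitrary: vs)
  case 0
  have "continuous_on K (iter_deriv f vs)"
    using assms(1,3)
    by (intro differentiable_imp_continuous_on differentiable_at_imp_differentiable_on)
      (auto simp: smooth_on_def)
  then have "bounded (iter_deriv f vs ` K)"
    by (intro compact_imp_bounded compact_continuous_image assms)
  then show ?case
    by (auto simp: bounded_iff)
next
  case (Suc k)
  then have "\<forall>b. \<exists>C. \<forall>y\<in>K. \<forall>h. \<bar>iter_deriv f (replicate k h @ b # vs) y\<bar> \<le> C * norm h ^ k"
    by blast
  from choice[OF this] obtain C where C: "\<And>b y h. y \<in> K \<Longrightarrow>
      \<bar>iter_deriv f (replicate k h @ b # vs) y\<bar> \<le> C b * norm h ^ k"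
    by blast
  have "\<bar>iter_deriv f (replicate (Suc k) h @ vs) y\<bar> \<le> (\<Sum>b\<in>Basis. C b) * norm h ^ Suc k"
    if "y \<in> K" for y h
  proof -
    have "iter_deriv f (replicate (Suc k) h @ vs) y = iter_deriv f (replicate k h @ h # vs) y"
      by (simp only: replicate_Suc replicate_append_same[symmetric]) simp
    also have "\<dots> = (\<Sum>b\<in>Basis. (h \<bullet> b) * iter_deriv f (replicate k h @ b # vs) y)"
      using smooth_on_slot_expansion[OF assms(1)] that assms(3) by blast
    also have "\<bar>\<dots>\<bar> \<le> (\<Sum>b\<in>Basis. norm h * (C b * norm h ^ k))"
      by (intro order_trans[OF sum_abs] sum_mono)
        (auto simp: abs_mult intro!: mult_mono Basis_le_norm C that)
    finally show ?thesis
      by (simp add: sum_distrib_right sum_distrib_left algebra_simps)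
  qed
  then show ?case by blast
qed

section \<open>Taylor expansion\<close>

lemma taylor_term_bigo:
  fixes f :: "'a::euclidean_space \<Rightarrow> real"
  assumes "smooth_on U f" "x \<in> U"
  shows "taylor_term k f x \<in> O[F](\<lambda>h. norm h ^ k)"
proof -
  obtain C where "\<And>h. \<bar>iter_deriv f (replicate k h @ []) x\<bar> \<le> C * norm h ^ k"
    using iter_deriv_replicate_bound[OF assms(1), of "{x}" k "[]"] assms(2) by auto
  then have "norm (taylor_term k f x h) \<le> (C / fact k) * norm (norm h ^ k)" for h
    by (simp add: taylor_term_def divide_right_mono)
  then show ?thesis
    by (intro bigoI always_eventually allI)
qed

text \<open>Restricting \<open>f\<close> to the segment from \<open>x\<close> to
  \<open>x + h\<close> reduces the claim to the one-variable Maclaurin formula with Lagrange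
  remainder, whose last term is bounded uniformly on a closed ball around \<open>x\<close>.\<close>

lemma taylor_remainder_bigo:
  fixes f :: "'a::euclidean_space \<Rightarrow> real"
  assumes "smooth_on U f" "x \<in> U"
  shows "(\<lambda>h. f (x + h) - (\<Sum>k<m. taylor_term k f x h)) \<in> O[at 0](\<lambda>h. norm h ^ m)"
proof -
  have "open U"
    using assms(1) by (simp add: smooth_on_def)
  then obtain r where r: "r > 0" "cball x r \<subseteq> U"
    using assms(2) open_contains_cball by blast
  obtain C where C: "\<And>y h. y \<in> cball x r \<Longrightarrow>
      \<bar>iter_deriv f (replicate m h @ []) y\<bar> \<le> C * norm h ^ m"
    using iter_deriv_replicate_bound[OF assms(1) compact_cball r(2)] by metis
  have "norm (f (x + h) - (\<Sum>k<m. taylor_term k f x h)) \<le> C / fact m * norm (norm h ^ m)"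
    if "norm h < r" for h
  proof -
    define \<phi> where "\<phi> k t = iter_deriv f (replicate k h) (x + t *\<^sub>R h)" for k t
    \<comment> \<open>The range of \<open>t\<close> is two-sided because
      \<open>Maclaurin_bi_le\<close> places the intermediate point in the interval from -1 to
      1.\<close>
    have in_ball: "x + t *\<^sub>R h \<in> cball x r" if "\<bar>t\<bar> \<le> 1" for t
      using mult_mono[OF that less_imp_le[OF \<open>norm h < r\<close>]] by (simp add: dist_norm)
    have \<phi>_deriv: "DERIV (\<phi> k) t :> \<phi> (Suc k) t" if "\<bar>t\<bar> \<le> 1" for k t
    proof -
      have "x + t *\<^sub>R h \<in> U"
        using in_ball[OF that] r(2) by blast
      note D = smooth_on_has_derivative[OF assms(1) this, of "replicate k h"]
      have "((\<lambda>t. x + t *\<^sub>R h) has_derivative (\<lambda>s. s *\<^sub>R h)) (at t)"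
        by (auto intro!: derivative_eq_intros)
      \<comment> \<open>The chain rule produces the derivative in direction
        \<open>s *\<^sub>R h\<close>; linearity pulls out \<open>s\<close>, leaving one more copy of
        \<open>h\<close> in the list.\<close>
      from has_derivative_compose[OF this D]
      show ?thesis
        unfolding has_field_derivative_def \<phi>_def
        by (rule has_derivative_eq_rhs)
          (simp add: fun_eq_iff linear_scale[OF has_derivative_linear[OF D]] del: iter_deriv.simps)
    qed
    obtain t where t: "\<bar>t\<bar> \<le> 1"
      "\<phi> 0 1 = (\<Sum>k<m. \<phi> k 0 / fact k * 1 ^ k) + \<phi> m t / fact m * 1 ^ m"
      using Maclaurin_bi_le[of \<phi> "\<phi> 0" m 1] \<phi>_deriv by auto
    have "\<bar>\<phi> m t\<bar> \<le> C * norm h ^ m"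
      using C[OF in_ball[OF t(1)]] by (simp add: \<phi>_def)
    moreover have "f (x + h) - (\<Sum>k<m. taylor_term k f x h) = \<phi> m t / fact m"
      using t(2) by (simp add: \<phi>_def taylor_term_def)
    ultimately show ?thesis
      by (simp add: divide_right_mono)
  qed
  moreover have "\<forall>\<^sub>F h in at 0. norm h < r"
    using r(1) by (auto simp: eventually_at intro!: exI[of _ r])
  ultimately show ?thesis
    by (intro bigoI[of _ "C / fact m"]) (rule eventually_mono)
qed

text \<open>Expanding through order five gives an error of order six. On adding the values at
  \<open>h\<close> and \<open>- h\<close>, orders 1, 3 and 5 cancel, while orders 0, 2 and 4
  double.\<close>

lemma even_taylor_bigo:
  fixes f :: "'a::euclidean_space \<Rightarrow> real"
  assumes "smooth_on U f" "x \<in> U"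
  shows "(\<lambda>h. (f (x + h) - 2 * f x + f (x - h)) - (2 * taylor_term 2 f x h + 2 * taylor_term 4 f x h))
    \<in> O[at 0](\<lambda>h. norm h ^ 6)"
proof -
  define R where "R h = f (x + h) - (\<Sum>k<6. taylor_term k f x h)" for h
  have R: "R \<in> O[at 0](\<lambda>h. norm h ^ 6)"
    unfolding R_def by (rule taylor_remainder_bigo[OF assms])
  \<comment> \<open>Reflection preserves punctured neighbourhoods of 0, so the remainder bound may
    be used at \<open>- h\<close>.\<close>
  have "filterlim uminus (at (0::'a)) (at 0)"
    by (auto simp: filterlim_at eventually_at_filter intro!: tendsto_eq_intros)
  from landau_o.big.compose[OF R this]
  have "(\<lambda>h. R h + R (- h)) \<in> O[at 0](\<lambda>h. norm h ^ 6)"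
    by (intro sum_in_bigo R) simp
  moreover have "R h + R (- h) =
      (f (x + h) - 2 * f x + f (x - h)) - (2 * taylor_term 2 f x h + 2 * taylor_term 4 f x h)" for h
    unfolding R_def taylor_term_uminus[OF assms]
    by (simp add: eval_nat_numeral) (simp add: taylor_term_def)
  ultimately show ?thesis
    by simp
qed

text \<open>The fourth order term is itself of order four, and near 0 the sixth power is dominated
  by the fourth.\<close>

lemma even_taylor_bigo_4:
  fixes f :: "'a::euclidean_space \<Rightarrow> real"
  assumes "smooth_on U f" "x \<in> U"
  shows "(\<lambda>h. (f (x + h) - 2 * f x + f (x - h)) - 2 * taylor_term 2 f x h) \<in> O[at 0](\<lambda>h. norm h ^ 4)"
proof -
  have "norm (norm h ^ 6) \<le> 1 * norm (norm h ^ 4)" if "norm h < 1" for h :: 'a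
    using that by (simp add: power_decreasing)
  moreover have "\<forall>\<^sub>F h::'a in at 0. norm h < 1"
    by (auto simp: eventually_at intro!: exI[of _ 1])
  ultimately have "(\<lambda>h::'a. norm h ^ 6) \<in> O[at 0](\<lambda>h. norm h ^ 4)"
    by (intro bigoI[of _ 1]) (auto elim!: eventually_mono)
  note small = landau_o.big_trans[OF even_taylor_bigo[OF assms] this]
  have "(\<lambda>h. 2 * taylor_term 4 f x h) \<in> O[at 0](\<lambda>h. norm h ^ 4)"
    using taylor_term_bigo[OF assms] by simp
  from sum_in_bigo(1)[OF small this] show ?thesis
    by (simp add: algebra_simps)
qed

lemma taylor_term_2_hessian:
  fixes f :: "real ^ 'n \<Rightarrow> real"
  assumes "smooth_on U f" "x \<in> U"
  shows "2 * taylor_term 2 f x h = h \<bullet> (hessian f x *v h)"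
proof -
  have axis_expansion: "iter_deriv f (ws @ h # vs) x =
      (\<Sum>i\<in>UNIV. h $ i * iter_deriv f (ws @ axis i 1 # vs) x)"
    for ws vs
  proof -
    note lin = smooth_on_slot_linear[OF assms, of ws vs]
    have "iter_deriv f (ws @ (\<Sum>i\<in>UNIV. h $ i *\<^sub>R axis i 1) # vs) x =
        (\<Sum>i\<in>UNIV. h $ i *\<^sub>R iter_deriv f (ws @ axis i 1 # vs) x)"
      by (simp add: linear_sum[OF lin] linear_scale[OF lin])
    then show ?thesis
      using basis_expansion[of h] by (simp add: scalar_mult_eq_scaleR)
  qed
  have "2 * taylor_term 2 f x h = iter_deriv f ([] @ h # [h]) x"
    by (simp add: taylor_term_def eval_nat_numeral)
  \<comment> \<open>The outer slot is expanded first, then the inner one, which matches the index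
    order in \<open>hessian\<close>.\<close>
  also have "\<dots> = (\<Sum>i\<in>UNIV. h $ i * iter_deriv f ([axis i 1] @ h # []) x)"
    by (subst axis_expansion) simp
  also have "\<dots> = (\<Sum>i\<in>UNIV. h $ i * (\<Sum>j\<in>UNIV. h $ j * iter_deriv f [axis i 1, axis j 1] x))"
    by (subst axis_expansion) simp
  also have "\<dots> = h \<bullet> (hessian f x *v h)"
    by (simp add: inner_vec_def matrix_vector_mult_def hessian_def mult.commute)
  finally show ?thesis .
qed

section \<open>Norms and the group\<close>

text \<open>This half of the equivalence of norms turns Euclidean error bounds into bounds in
  \<open>N\<close>. The constant is the reciprocal of the minimum of \<open>N\<close> on the
  Euclidean unit sphere, and homogeneity extends the bound to all vectors.\<close>

lemma is_norm_dominates_norm: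
  fixes N :: "'a::euclidean_space \<Rightarrow> real"
  assumes "is_norm N"
  shows "\<exists>c. \<forall>x. norm x \<le> c * N x"
proof -
  have N: "N x \<ge> 0" "N x = 0 \<longleftrightarrow> x = 0" "N (c *\<^sub>R x) = \<bar>c\<bar> * N x" "N (x + y) \<le> N x + N y" for c x y
    using assms by (auto simp: is_norm_def)
  \<comment> \<open>Convexity supplies continuity: a finite convex function on a finite-dimensional
    space is continuous, so the minimum on the compact sphere is attained.\<close>
  have "convex_on UNIV N"
  proof (rule convex_onI)
    fix t :: real and x y :: 'a
    assume "0 < t" "t < 1"
    then show "N ((1 - t) *\<^sub>R x + t *\<^sub>R y) \<le> (1 - t) * N x + t * N y"
      using N(4)[of "(1 - t) *\<^sub>R x" "t *\<^sub>R y"] by (simp add: N(3))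
  qed simp
  then have "continuous_on (sphere 0 1) N"
    using convex_on_continuous[of UNIV N] continuous_on_subset by blast
  moreover have "sphere (0::'a) 1 \<noteq> {}"
    by simp
  ultimately obtain u where u: "u \<in> sphere 0 1" "\<And>y. y \<in> sphere 0 1 \<Longrightarrow> N u \<le> N y"
    using continuous_attains_inf[of "sphere (0::'a) 1" N] by auto
  have "N u > 0"
    using u(1) N(1,2)[of u] by fastforce
  have "norm x \<le> 1 / N u * N x" for x
  proof (cases "x = 0")
    case False
    then have "N u \<le> N (x /\<^sub>R norm x)"
      by (intro u(2)) simp
    then show ?thesis
      using False \<open>N u > 0\<close> by (simp add: N(3) field_simps)
  qed (simp add: N)
  then show ?thesis by blast
qed

lemma norm_power_bigo_is_norm:
  fixes N :: "'a::euclidean_space \<Rightarrow> real"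
  assumes "is_norm N"
  shows "(\<lambda>h. norm h ^ k) \<in> O[F](\<lambda>h. N h ^ k)"
proof -
  obtain c where "\<And>x. norm x \<le> c * N x"
    using is_norm_dominates_norm[OF assms] by blast
  then have "(\<lambda>h. norm h) \<in> O[F](N)"
    using assms by (intro bigoI[of _ c]) (auto simp: is_norm_def)
  then show ?thesis
    by (rule landau_o.big_power)
qed

lemma Gamma_group_orthogonal:
  fixes V :: "real ^ 'n ^ 'n"
  assumes "orthogonal_matrix V" "\<gamma> \<in> Gamma_group V"
  shows "orthogonal_matrix \<gamma>"
proof -
  obtain S where S: "\<gamma> = transpose V ** S ** V" "S \<in> sign_matrices"
    using assms(2) by (auto simp: Gamma_group_def)
  then have offdiag: "S $ i $ j = 0" if "i \<noteq> j" for i j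
    using that by (auto simp: sign_matrices_def)
  have diag: "S $ i $ i * S $ i $ i = 1" for i
    using S(2) by (auto simp: sign_matrices_def) (metis mult_1 minus_mult_minus)
  have "(\<Sum>k\<in>UNIV. S $ k $ i * S $ k $ j) = (if i = j then 1 else 0)" for i j
  proof -
    \<comment> \<open>Column \<open>i\<close> of the diagonal matrix \<open>S\<close> has its only
      nonzero entry in row \<open>i\<close>.\<close>
    have "(\<Sum>k\<in>UNIV. S $ k $ i * S $ k $ j) = (\<Sum>k\<in>UNIV. if k = i then S $ i $ i * S $ i $ j else 0)"
      by (intro sum.cong) (auto simp: offdiag)
    then show ?thesis
      by (simp add: diag offdiag)
  qed
  then have "orthogonal_matrix S"
    by (simp add: orthogonal_matrix matrix_matrix_mult_def transpose_def mat_def)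
  then show ?thesis
    unfolding S(1) using assms(1)
    by (intro orthogonal_matrix_mul) (simp_all add: orthogonal_matrix_transpose)
qed

lemma orthogonal_matrix_norm:
  fixes A :: "real ^ 'n ^ 'n"
  assumes "orthogonal_matrix A"
  shows "norm (A *v h) = norm h"
  using assms by (intro orthogonal_transformation_norm) (simp add: orthogonal_transformation_matrix)

text \<open>Commuting moves \<open>A\<close> to the left of \<open>H\<close>, and then the
  orthogonal \<open>A\<close> cancels from both sides of the inner product.\<close>

lemma orthogonal_commute_quadratic_form:
  fixes A H :: "real ^ 'n ^ 'n"
  assumes "orthogonal_matrix A" "A ** H = H ** A"
  shows "(A *v h) \<bullet> (H *v (A *v h)) = h \<bullet> (H *v h)"
proof -
  have "(A *v h) \<bullet> (H *v (A *v h)) = (A *v h) \<bullet> (A *v (H *v h))"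
    by (simp add: matrix_vector_mul_assoc assms(2))
  also have "\<dots> = h \<bullet> (H *v h)"
    using assms(1) orthogonal_transformation_matrix[of "(*v) A"]
    by (simp add: orthogonal_transformation_def)
  finally show ?thesis .
qed

text \<open>This licenses substituting \<open>A *v h\<close> for \<open>h\<close> in an estimate at
  0. The filter \<open>at 0\<close> excludes 0 itself, so \<open>A\<close> must also send nonzero
  vectors to nonzero vectors, which follows from preservation of the norm.\<close>

lemma filterlim_orthogonal_matrix:
  fixes A :: "real ^ 'n ^ 'n"
  assumes "orthogonal_matrix A"
  shows "filterlim ((*v) A) (at 0) (at 0)"
proof -
  have "((*v) A \<longlongrightarrow> A *v 0) (at 0)"
    by (intro linear_continuous_at[unfolded isCont_def] matrix_vector_mul_bounded_linear)
  moreover have "A *v h \<noteq> 0" if "h \<noteq> 0" for h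
    using that orthogonal_matrix_norm[OF assms, of h] by auto
  ultimately show ?thesis
    by (auto simp: filterlim_at eventually_at_filter)
qed

theorem corollary3p1:
  fixes f :: "real ^ 'n \<Rightarrow> real" and xbar :: "real ^ 'n" and V :: "real ^ 'n ^ 'n"
    and N :: "real ^ 'n \<Rightarrow> real"
  assumes "is_norm N"
    and "\<exists>U. xbar \<in> U \<and> smooth_on U f"
    and "orthogonal_matrix V"
    and "\<forall>\<gamma> \<in> Gamma_group V. \<gamma> ** hessian f xbar = hessian f xbar ** \<gamma>"
  shows "(\<forall>\<gamma> \<in> Gamma_group V.
           (\<lambda>h. (f (xbar + \<gamma> *v h) - 2 * f xbar + f (xbar - \<gamma> *v h))
                - (h \<bullet> (hessian f xbar *v h) + 2 * taylor_term 4 f xbar (\<gamma> *v h)))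
             \<in> O[at 0](\<lambda>h. N h ^ 6))
       \<and> (\<forall>\<gamma>1 \<in> Gamma_group V. \<forall>\<gamma>2 \<in> Gamma_group V.
           (\<lambda>h. (f (xbar + \<gamma>1 *v h) + f (xbar - \<gamma>1 *v h)
                  - f (xbar + \<gamma>2 *v h) - f (xbar - \<gamma>2 *v h))
                - 2 * (taylor_term 4 f xbar (\<gamma>1 *v h) - taylor_term 4 f xbar (\<gamma>2 *v h)))
             \<in> O[at 0](\<lambda>h. N h ^ 6))
       \<and> (\<forall>\<gamma>1 \<in> Gamma_group V. \<forall>\<gamma>2 \<in> Gamma_group V.
           (\<lambda>h. f (xbar + \<gamma>1 *v h) + f (xbar - \<gamma>1 *v h)
                  - f (xbar + \<gamma>2 *v h) - f (xbar - \<gamma>2 *v h))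
             \<in> O[at 0](\<lambda>h. N h ^ 4))"
proof -
  obtain U where U: "smooth_on U f" "xbar \<in> U"
    using assms(2) by blast
  note orth = Gamma_group_orthogonal[OF assms(3)]
  \<comment> \<open>An estimate in \<open>h\<close> is pulled back along \<gamma>, which leaves the
    Euclidean norm unchanged, and only then weakened to the norm \<open>N\<close>.\<close>
  have bigo_N: "(\<lambda>h. F (\<gamma> *v h)) \<in> O[at 0](\<lambda>h. N h ^ k)"
    if "F \<in> O[at 0](\<lambda>h. norm h ^ k)" "\<gamma> \<in> Gamma_group V" for F :: "real ^ 'n \<Rightarrow> real" and \<gamma> k
  proof -
    have "(\<lambda>h. F (\<gamma> *v h)) \<in> O[at 0](\<lambda>h. norm h ^ k)"
      using landau_o.big.compose[OF that(1) filterlim_orthogonal_matrix[OF orth[OF that(2)]]]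
      by (simp add: orthogonal_matrix_norm[OF orth[OF that(2)]])
    then show ?thesis
      by (rule landau_o.big_trans) (rule norm_power_bigo_is_norm[OF assms(1)])
  qed
  \<comment> \<open>Here the commutation hypothesis enters: the quadratic term is the same for every
    \<gamma>, so it cancels in the differences below.\<close>
  have quadratic: "2 * taylor_term 2 f xbar (\<gamma> *v h) = h \<bullet> (hessian f xbar *v h)"
    if "\<gamma> \<in> Gamma_group V" for \<gamma> h
    unfolding taylor_term_2_hessian[OF U]
    using orthogonal_commute_quadratic_form[OF orth] assms(4) that by blast
  have first: "(\<lambda>h. (f (xbar + \<gamma> *v h) - 2 * f xbar + f (xbar - \<gamma> *v h))
      - (h \<bullet> (hessian f xbar *v h) + 2 * taylor_term 4 f xbar (\<gamma> *v h))) \<in> O[at 0](\<lambda>h. N h ^ 6)"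
    if "\<gamma> \<in> Gamma_group V" for \<gamma>
    using bigo_N[OF even_taylor_bigo[OF U] that] by (simp add: quadratic that)
  have second: "(\<lambda>h. (f (xbar + \<gamma>1 *v h) + f (xbar - \<gamma>1 *v h)
        - f (xbar + \<gamma>2 *v h) - f (xbar - \<gamma>2 *v h))
        - 2 * (taylor_term 4 f xbar (\<gamma>1 *v h) - taylor_term 4 f xbar (\<gamma>2 *v h)))
      \<in> O[at 0](\<lambda>h. N h ^ 6)"
    if "\<gamma>1 \<in> Gamma_group V" "\<gamma>2 \<in> Gamma_group V" for \<gamma>1 \<gamma>2
    using sum_in_bigo(2)[OF first[OF that(1)] first[OF that(2)]] by (simp add: algebra_simps)
  \<comment> \<open>The subtraction is repeated with the fourth order estimate, where the terms
    \<open>taylor_term 4\<close> are already part of the error.\<close>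
  have "(\<lambda>h. f (xbar + \<gamma>1 *v h) + f (xbar - \<gamma>1 *v h)
        - f (xbar + \<gamma>2 *v h) - f (xbar - \<gamma>2 *v h)) \<in> O[at 0](\<lambda>h. N h ^ 4)"
    if "\<gamma>1 \<in> Gamma_group V" "\<gamma>2 \<in> Gamma_group V" for \<gamma>1 \<gamma>2
    using sum_in_bigo(2)[OF bigo_N[OF even_taylor_bigo_4[OF U] that(1)]
        bigo_N[OF even_taylor_bigo_4[OF U] that(2)]]
    by (simp add: quadratic that algebra_simps)
  then show ?thesis
    using first second by blast
qed

end
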